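(* Let $n\ge 1$ and let $K_{1,n}$ be the star with $n$ leaves. When $n$ is odd, $\chi_g^\infty(K_{1,n}) \leq \lceil \frac{n}{2} \rceil + 2$. When $n \geq 4$ is even, $\chi_g^\infty(K_{1,n}) \leq \frac{n}{2}+3$.
   Context: The eternal vertex coloring game (A-game) on a finite undirected graph $G$ with color set $\{1,\ldots,k\}$: all vertices are initially uncolored. Alice and Bob strictly alternate turns, Alice moving first overall. On a turn the player chooses one vertex. If it is uncolored, the player must give it a color not currently used on any of its neighbors; if it currently has color $c$, the player must change its color to a color different from $c$ that is not currently used on any of its neighbors. The player whose turn it is picks the vertex and the new color. Play proceeds in rounds: every vertex must be chosen $t$ times before any vertex is chosen $t+1$ times, for every integer $t\ge 1$ (so each vertex is chosen exactly once per round; turns keep alternating across rounds, so if $|V(G)|$ is odd Bob moves first in even-numbered rounds). If some player chooses a vertex $v$ (still available in the current round) that cannot be legally colored, i.e. every color in the color set other than the current color of $v$ (if any) appears on a neighbor of $v$, then Bob wins. In particular Bob may deliberately choose such a vertex. Alice wins if this never happens (the game goes on forever). The eternal game chromatic number $\chi_g^\infty(G)$ is the minimum $k$ such that Alice has a winning strategy on $G$ with $k$ colors. *)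

theory Defs
  imports "Graph_Theory.Pair_Digraph" "HOL-Library.Extended_Nat" Complex_Main
begin

text \<open>
  Finite simple undirected graphs are the symmetric, loop-free, finite digraphs without parallel
  arcs of locale \<^locale>\<open>pair_graph\<close>; each edge is represented by its two arcs.
\<close>

definition star_graph :: "nat \<Rightarrow> nat pair_pre_digraph" where
  "star_graph n = \<lparr> pverts = {0..n}, parcs = {0} \<times> {1..n} \<union> {1..n} \<times> {0} \<rparr>"

lemma pair_graph_star_graph: "pair_graph (star_graph n)"
  by unfold_locales
    (auto simp: star_graph_def symmetric_def arcs_ends_conv intro!: symI)

text \<open>
  A position of the game is given by its history: the chronological list of all moves
  (chosen vertex, new colour) made so far by both players.
\<close>

type_synonym 'v history = "('v \<times> nat) list"

definition current_colour :: "'v history \<Rightarrow> 'v \<Rightarrow> nat option" where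
  "current_colour h v = map_of (rev h) v"

definition times_chosen :: "'v history \<Rightarrow> 'v \<Rightarrow> nat" where
  "times_chosen h v = count_list (map fst h) v"

text \<open>
  The round condition: a vertex may be chosen for the \<open>(t + 1)\<close>-st time only when every vertex has
  been chosen at least \<open>t\<close> times.
\<close>

definition may_choose :: "'v pair_pre_digraph \<Rightarrow> 'v history \<Rightarrow> 'v \<Rightarrow> bool" where
  "may_choose G h v \<longleftrightarrow>
     v \<in> pverts G \<and> (\<forall>u \<in> pverts G. times_chosen h v \<le> times_chosen h u)"

definition legal_colour :: "'v pair_pre_digraph \<Rightarrow> nat \<Rightarrow> 'v history \<Rightarrow> 'v \<Rightarrow> nat \<Rightarrow> bool" where
  "legal_colour G k h v c \<longleftrightarrow>
     c \<in> {1..k} \<and> current_colour h v \<noteq> Some c \<and>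
     (\<forall>u. (u, v) \<in> parcs G \<longrightarrow> current_colour h u \<noteq> Some c)"

definition legal_move :: "'v pair_pre_digraph \<Rightarrow> nat \<Rightarrow> 'v history \<Rightarrow> 'v \<times> nat \<Rightarrow> bool" where
  "legal_move G k h m \<longleftrightarrow> may_choose G h (fst m) \<and> legal_colour G k h (fst m) (snd m)"

definition stuck :: "'v pair_pre_digraph \<Rightarrow> nat \<Rightarrow> 'v history \<Rightarrow> 'v \<Rightarrow> bool" where
  "stuck G k h v \<longleftrightarrow> may_choose G h v \<and> (\<nexists>c. legal_colour G k h v c)"

definition alice_to_move :: "'v history \<Rightarrow> bool" where
  "alice_to_move h \<longleftrightarrow> even (length h)"

text \<open>
  A strategy for Alice may depend on the whole history. The histories reachable under \<open>\<sigma>\<close> are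
  those in which Alice has followed \<open>\<sigma>\<close>, Bob has moved arbitrarily, and no vertex that cannot be
  coloured has been chosen.
\<close>

inductive reachable ::
  "'v pair_pre_digraph \<Rightarrow> nat \<Rightarrow> ('v history \<Rightarrow> 'v \<times> nat) \<Rightarrow> 'v history \<Rightarrow> bool"
  for G k \<sigma> where
  start: "reachable G k \<sigma> []"
| alice: "reachable G k \<sigma> h \<Longrightarrow> alice_to_move h \<Longrightarrow> legal_move G k h (\<sigma> h) \<Longrightarrow>
    reachable G k \<sigma> (h @ [\<sigma> h])"
| bob: "reachable G k \<sigma> h \<Longrightarrow> \<not> alice_to_move h \<Longrightarrow> legal_move G k h m \<Longrightarrow>
    reachable G k \<sigma> (h @ [m])"

text \<open>
  Bob wins as soon as either player chooses a vertex that cannot be coloured. So \<open>\<sigma>\<close> wins iff, along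
  all plays following it, \<open>\<sigma>\<close> always prescribes a legal move on Alice's turns, and on Bob's turns
  no vertex that he may choose is stuck.
\<close>

definition winning_strategy ::
  "'v pair_pre_digraph \<Rightarrow> nat \<Rightarrow> ('v history \<Rightarrow> 'v \<times> nat) \<Rightarrow> bool" where
  "winning_strategy G k \<sigma> \<longleftrightarrow>
     (\<forall>h. reachable G k \<sigma> h \<longrightarrow>
        (if alice_to_move h then legal_move G k h (\<sigma> h) else (\<nexists>v. stuck G k h v)))"

definition alice_wins :: "'v pair_pre_digraph \<Rightarrow> nat \<Rightarrow> bool" where
  "alice_wins G k \<longleftrightarrow> (\<exists>\<sigma>. winning_strategy G k \<sigma>)"

text \<open>
  Taken in \<^typ>\<open>enat\<close>, the infimum is attained whenever Alice wins for some number of colours, and it is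
  \<open>\<infinity>\<close> otherwise; thus a finite upper bound entails that the minimum exists.
\<close>

definition eternal_game_chromatic_number :: "'v pair_pre_digraph \<Rightarrow> enat" where
  "eternal_game_chromatic_number G = (INF k \<in> {k. alice_wins G k}. enat k)"

end

(*
  With k = M + 2 colours, the centre is stuck only when the leaves show at least M + 1 colours.
  In a round, let U be the set of colours given to the leaves played so far and r the number of
  unplayed leaves.  Alice recolours leaves with colours from U whenever she can, so that U grows
  only with Bob's remaining (about r/2) leaf moves and card U stays at most M until the round ends.
  As long as the centre has not been played, old colours count as well: if Bob makes the leaves
  show M + 1 colours, some unplayed leaf carries a colour that occurs only there, by pigeonhole,
  and Alice removes this colour by copying a colour from U.  She plays the centre first when n is
  even or n = 1, and a leaf first when n >= 3 is odd: there, in a round opened at the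
  centre, Bob's first move could produce the colour of all unplayed leaves; Alice could then not
  copy it, and the extra colour she needs would not be affordable.
*)

theory Submission
  imports Defs
begin

section \<open>Games won by an invariant\<close>

text \<open>No strategy is written down: Alice picks by choice any legal move that keeps
  \<open>I\<close>, and induction over reachable histories does the rest.\<close>

lemma alice_wins_by_invariant:
  assumes start: "I []"
    and alice: "\<And>h. I h \<Longrightarrow> alice_to_move h \<Longrightarrow> \<exists>m. legal_move G k h m \<and> I (h @ [m])"
    and not_stuck: "\<And>h v. I h \<Longrightarrow> \<not> alice_to_move h \<Longrightarrow> \<not> stuck G k h v"
    and bob: "\<And>h m. I h \<Longrightarrow> \<not> alice_to_move h \<Longrightarrow> legal_move G k h m \<Longrightarrow> I (h @ [m])"
  shows "alice_wins G k"
proof -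
  define \<sigma> where "\<sigma> h = (SOME m. legal_move G k h m \<and> I (h @ [m]))" for h
  have \<sigma>: "legal_move G k h (\<sigma> h) \<and> I (h @ [\<sigma> h])" if "I h" "alice_to_move h" for h
    unfolding \<sigma>_def using alice[OF that] by (rule someI_ex)
  have "I h" if "reachable G k \<sigma> h" for h
    using that by induction (use start \<sigma> bob in auto)
  then have "winning_strategy G k \<sigma>"
    unfolding winning_strategy_def using \<sigma> not_stuck by auto
  then show ?thesis
    unfolding alice_wins_def by blast
qed

lemma eternal_game_chromatic_number_le:
  "alice_wins G k \<Longrightarrow> eternal_game_chromatic_number G \<le> enat k"
  unfolding eternal_game_chromatic_number_def by (rule INF_lower) simp

section \<open>Colours and available vertices along a history\<close>

lemma current_colour_Nil [simp]: "current_colour [] = (\<lambda>_. None)"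
  by (simp add: current_colour_def fun_eq_iff)

lemma current_colour_snoc [simp]:
  "current_colour (h @ [(v, c)]) = (current_colour h)(v := Some c)"
  by (simp add: current_colour_def fun_eq_iff)

lemma times_chosen_snoc [simp]:
  "times_chosen (h @ [(v, c)]) u = times_chosen h u + (if u = v then 1 else 0)"
  by (simp add: times_chosen_def)

definition balanced :: "'v pair_pre_digraph \<Rightarrow> 'v history \<Rightarrow> bool" where
  "balanced G h \<longleftrightarrow>
     (\<exists>t. \<forall>u \<in> pverts G. t \<le> times_chosen h u \<and> times_chosen h u \<le> Suc t)"

lemma balanced_snoc:
  assumes "balanced G h" and v: "may_choose G h v"
  shows "balanced G (h @ [(v, c)])"
proof -
  obtain t where t: "\<And>u. u \<in> pverts G \<Longrightarrow> t \<le> times_chosen h u \<and> times_chosen h u \<le> Suc t"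
    using assms(1) unfolding balanced_def by blast
  show ?thesis
  proof (cases "times_chosen h v = t")
    case True
    then show ?thesis
      unfolding balanced_def using t by (intro exI[of _ t]) auto
  next
    case False
    then have "times_chosen h u = Suc t" if "u \<in> pverts G" for u
      using t[OF that] t[of v] v that unfolding may_choose_def by fastforce
    then show ?thesis
      unfolding balanced_def by (intro exI[of _ "Suc t"]) auto
  qed
qed

text \<open>The available vertices are those with the least count. Counts differ by at most one, so
  choosing the last available vertex makes all counts equal and opens a new round.\<close>

lemma available_snoc:
  assumes "balanced G h" and v: "may_choose G h v"
  shows "Collect (may_choose G (h @ [(v, c)])) =
    (if Collect (may_choose G h) = {v} then pverts G else Collect (may_choose G h) - {v})"
proof -
  obtain t where t: "\<And>u. u \<in> pverts G \<Longrightarrow> t \<le> times_chosen h u \<and> times_chosen h u \<le> Suc t"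
    using assms(1) unfolding balanced_def by blast
  have vG: "v \<in> pverts G"
    and min: "\<And>u. u \<in> pverts G \<Longrightarrow> times_chosen h v \<le> times_chosen h u"
    using v unfolding may_choose_def by auto
  have avail: "may_choose G h u \<longleftrightarrow> u \<in> pverts G \<and> times_chosen h u = times_chosen h v" for u
    unfolding may_choose_def using min vG by (auto intro: antisym)
  show ?thesis
  proof (cases "Collect (may_choose G h) = {v}")
    case True
    then have "times_chosen h u = Suc (times_chosen h v)" if "u \<in> pverts G" "u \<noteq> v" for u
      using that avail[of u] min[OF that(1)] t[OF that(1)] t[OF vG] by fastforce
    then show ?thesis
      using True by (auto simp: may_choose_def)
  next
    case False
    then obtain w where w: "w \<in> pverts G" "times_chosen h w = times_chosen h v" "w \<noteq> v"
      using v avail by blast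
    have "may_choose G (h @ [(v, c)]) u \<longleftrightarrow> may_choose G h u \<and> u \<noteq> v" for u
    proof
      assume u: "may_choose G (h @ [(v, c)]) u"
      then have "times_chosen (h @ [(v, c)]) u \<le> times_chosen (h @ [(v, c)]) w" "u \<in> pverts G"
        unfolding may_choose_def using w by blast+
      then show "may_choose G h u \<and> u \<noteq> v"
        using w min[of u] unfolding avail by (auto split: if_splits)
    next
      assume "may_choose G h u \<and> u \<noteq> v"
      then show "may_choose G (h @ [(v, c)]) u"
        unfolding may_choose_def by fastforce
    qed
    then show ?thesis
      using False by auto
  qed
qed

section \<open>Sets of colours\<close>

definition colours :: "('v \<Rightarrow> nat option) \<Rightarrow> 'v set \<Rightarrow> nat set" where
  "colours col X = {c. \<exists>v\<in>X. col v = Some c}"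

lemma finite_colours [simp]: "finite X \<Longrightarrow> finite (colours col X)"
  by (rule finite_subset[of _ "(the \<circ> col) ` X"]) (force simp: colours_def)+

lemma colours_empty [simp]: "colours col {} = {}"
  by (simp add: colours_def)

lemma colours_mono: "X \<subseteq> Y \<Longrightarrow> colours col X \<subseteq> colours col Y"
  by (auto simp: colours_def)

lemma colours_upd_notin [simp]: "v \<notin> X \<Longrightarrow> colours (col(v := d)) X = colours col X"
  by (auto simp: colours_def)

lemma colours_upd_insert:
  "v \<notin> X \<Longrightarrow> colours (col(v := Some c)) (insert v X) = insert c (colours col X)"
  by (auto simp: colours_def)

lemma colours_upd_subset: "colours (col(v := Some c)) X \<subseteq> insert c (colours col X)"
  by (auto simp: colours_def)

text \<open>Double counting: if each colour that occurs on \<open>Y\<close> but not on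
  \<open>X - Y\<close> occurred twice, these colours would need at least twice as many vertices in
  \<open>Y\<close>.\<close>

lemma ex_unique_colour:
  assumes fin: "finite X" and Y: "Y \<subseteq> X"
    and few: "card Y < 2 * (card (colours col X) - card (colours col (X - Y)))"
  obtains v s where "v \<in> Y" "col v = Some s" "s \<notin> colours col (X - {v})"
proof (rule ccontr)
  assume "\<not> thesis"
  then have no: False if "v \<in> Y" "col v = Some s" "s \<notin> colours col (X - {v})" for v s
    using that \<open>\<And>v s. v \<in> Y \<Longrightarrow> col v = Some s \<Longrightarrow> s \<notin> colours col (X - {v}) \<Longrightarrow> thesis\<close> by blast
  define D where "D = colours col X - colours col (X - Y)"
  have fY: "finite Y" and fD: "finite D"
    using fin Y finite_subset by (auto simp: D_def)
  have "2 \<le> card {v\<in>Y. col v = Some s}" if s: "s \<in> D" for s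
  proof -
    obtain v where v: "v \<in> Y" "col v = Some s"
      using s by (auto simp: D_def colours_def)
    then have "s \<in> colours col (X - {v})"
      using no by blast
    then obtain w where w: "w \<in> Y" "w \<noteq> v" "col w = Some s"
      using s by (auto simp: D_def colours_def)
    then have "card {v, w} \<le> card {v\<in>Y. col v = Some s}"
      using v fY by (intro card_mono) auto
    then show ?thesis
      using w by simp
  qed
  then have "2 * card D \<le> (\<Sum>s\<in>D. card {v\<in>Y. col v = Some s})"
    using sum_bounded_below[of D 2 "\<lambda>s. card {v\<in>Y. col v = Some s}"] by (simp add: mult.commute)
  also have "\<dots> = card (\<Union>s\<in>D. {v\<in>Y. col v = Some s})"
    using fD fY by (intro card_UN_disjoint[symmetric]) auto
  also have "\<dots> \<le> card Y"
    using fY by (intro card_mono) auto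
  finally have "2 * card D \<le> card Y" .
  moreover have "card D = card (colours col X) - card (colours col (X - Y))"
    unfolding D_def using fin colours_mono[of "X - Y" X col] by (intro card_Diff_subset) auto
  ultimately show False
    using few by simp
qed

lemma ex_other_element:
  assumes "2 \<le> card S"
  obtains x where "x \<in> S" "y \<noteq> Some x"
proof -
  have "\<exists>x\<in>S. y \<noteq> Some x"
  proof (rule ccontr)
    assume "\<not> ?thesis"
    then have "S \<subseteq> {the y}" by (metis insertI1 option.sel subsetI)
    then have "card S \<le> 1"
      using card_mono[of "{the y}" S] by simp
    then show False using assms by simp
  qed
  then show ?thesis using that by blast
qed

section \<open>The star\<close>

text \<open>\<open>M\<close> leaf colours and the centre's own colour leave one of
  \<open>M + 2\<close> for the centre. For odd \<open>n\<close> Alice opens every round, and one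
  colour from her plus \<open>(n - 1) div 2\<close> from Bob make \<open>M\<close>. For even
  \<open>n\<close> Bob opens some rounds; then \<open>used\<close> is empty and only the second
  disjunct of \<open>flexible\<close> can hold, which requires
  \<open>n div 2 + 1 \<le> M\<close>.\<close>

locale star_game =
  fixes n k M :: nat
  assumes k_eq: "k = M + 2"
    and n_pos: "1 \<le> n"
    and odd_n: "odd n \<Longrightarrow> 2 * M = n + 1"
    and even_n: "even n \<Longrightarrow> 2 * M = n + 2"
begin

lemma M_pos: "1 \<le> M"
  using odd_n even_n n_pos by (cases "odd n") auto

abbreviation seen :: "(nat \<Rightarrow> nat option) \<Rightarrow> nat set" where
  "seen col \<equiv> colours col {1..n}"

text \<open>\<open>A\<close> is always the set of vertices still to be chosen in the round, so this
  is the set U of the overview and \<open>rest A\<close> is its r.\<close>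

abbreviation used :: "(nat \<Rightarrow> nat option) \<Rightarrow> nat set \<Rightarrow> nat set" where
  "used col A \<equiv> colours col ({1..n} - A)"

abbreviation rest :: "nat set \<Rightarrow> nat" where
  "rest A \<equiv> card (A \<inter> {1..n})"

definition legal :: "(nat \<Rightarrow> nat option) \<Rightarrow> nat \<Rightarrow> nat \<Rightarrow> bool" where
  "legal col v c \<longleftrightarrow> c \<in> {1..k} \<and> col v \<noteq> Some c \<and>
     (if v = 0 then c \<notin> seen col else col 0 \<noteq> Some c)"

lemma legal_colour_star:
  "v \<in> {0..n} \<Longrightarrow> legal_colour (star_graph n) k h v c \<longleftrightarrow> legal (current_colour h) v c"
  by (auto simp: legal_colour_def legal_def star_graph_def colours_def)

definition available_after :: "nat set \<Rightarrow> nat \<Rightarrow> nat set" where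
  "available_after A v = (if A = {v} then {0..n} else A - {v})"

definition position :: "(nat \<Rightarrow> nat option) \<Rightarrow> nat set \<Rightarrow> bool" where
  "position col A \<longleftrightarrow> A \<subseteq> {0..n} \<and> A \<noteq> {} \<and> seen col \<subseteq> {1..k} \<and>
     (\<forall>c\<in>seen col. col 0 \<noteq> Some c)"

text \<open>Ways for Alice to play a leaf within budget: of two used colours one differs from the
  leaf's own; or there is slack for one new colour; or the only used colour can be copied to a leaf
  that does not carry it.\<close>

definition flexible :: "(nat \<Rightarrow> nat option) \<Rightarrow> nat set \<Rightarrow> bool" where
  "flexible col A \<longleftrightarrow> 2 \<le> card (used col A) \<or> card (used col A) + rest A div 2 + 1 \<le> M \<or>
     (\<exists>y. used col A = {y} \<and> (\<exists>l\<in>A \<inter> {1..n}. col l \<noteq> Some y))"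

text \<open>The halves of \<open>rest A\<close> count Bob's leaf moves to come. Once the centre is
  done, \<open>seen\<close> needs no bound: at the end of the round the leaves show only used
  colours. The last disjunction makes Bob's next leaf move lead to \<open>flexible\<close>, unless
  that move ends the round.\<close>

definition bob_inv :: "(nat \<Rightarrow> nat option) \<Rightarrow> nat set \<Rightarrow> bool" where
  "bob_inv col A \<longleftrightarrow> position col A \<and>
     (if 0 \<in> A then
        even (rest A) \<and> card (seen col) \<le> M \<and> card (used col A) + rest A div 2 \<le> M \<and>
        flexible col A
      else
        (odd n \<longrightarrow> odd (rest A)) \<and> card (used col A) + (rest A + 1) div 2 \<le> M \<and>
        (used col A \<noteq> {} \<or> card (used col A) + (rest A + 1) div 2 + 1 \<le> M \<or> rest A \<le> 1))"

text \<open>In mid-round with the centre open, Bob's leaf move may have pushed both bounds to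
  \<open>M + 1\<close>; Alice's reply must bring them back to \<open>M\<close>. The last clause
  there says that she can copy onto any leaf or can afford to play the centre.\<close>

definition alice_inv :: "(nat \<Rightarrow> nat option) \<Rightarrow> nat set \<Rightarrow> bool" where
  "alice_inv col A \<longleftrightarrow> position col A \<and>
     (if 0 \<in> A then
        A = {0..n} \<and> card (seen col) \<le> M \<or>
        odd (rest A) \<and> used col A \<noteq> {} \<and> card (seen col) \<le> M + 1 \<and>
        card (used col A) + (rest A + 1) div 2 \<le> M + 1 \<and>
        (2 \<le> card (used col A) \<or> card (used col A) + (rest A + 1) div 2 \<le> M)
      else
        (odd n \<longrightarrow> even (rest A)) \<and> card (used col A) + rest A div 2 \<le> M \<and> flexible col A)"

section \<open>Effect of one move on the colour sets\<close>

lemma position_step: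
  assumes "position col A" "v \<in> A" "legal col v c"
  shows "position (col(v := Some c)) (available_after A v)"
proof -
  have "available_after A v \<subseteq> {0..n}" "available_after A v \<noteq> {}"
    using assms by (auto simp: position_def available_after_def)
  moreover have "seen (col(v := Some c)) \<subseteq> {1..k}"
    using assms colours_upd_subset[of col v c "{1..n}"] by (auto simp: position_def legal_def)
  moreover have "\<forall>d\<in>seen (col(v := Some c)). (col(v := Some c)) 0 \<noteq> Some d"
  proof (cases "v = 0")
    case True
    then show ?thesis using assms by (auto simp: legal_def)
  next
    case False
    then show ?thesis
      using assms colours_upd_subset[of col v c "{1..n}"] by (auto simp: position_def legal_def)
  qed
  ultimately show ?thesis by (simp add: position_def)
qed

lemma used_leaf_step:
  assumes "l \<in> A" "l \<in> {1..n}"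
  shows "used (col(l := Some c)) (A - {l}) = insert c (used col A)"
proof -
  have "{1..n} - (A - {l}) = insert l ({1..n} - A)"
    using assms by auto
  then show ?thesis
    using assms by (simp add: colours_upd_insert)
qed

lemma rest_leaf_step:
  assumes "l \<in> A" "l \<in> {1..n}"
  shows "rest (A - {l}) = rest A - 1" "0 < rest A"
proof -
  have "(A - {l}) \<inter> {1..n} = (A \<inter> {1..n}) - {l}" by auto
  then show "rest (A - {l}) = rest A - 1"
    using assms by simp
  show "0 < rest A"
    using assms by (auto simp: card_gt_0_iff)
qed

lemma rest_centre_step: "rest (A - {0}) = rest A"
  by (rule arg_cong[of _ _ card]) auto

lemma used_centre_step: "used (col(0 := d)) (A - {0}) = used col A"
proof -
  have "{1..n} - (A - {0}) = {1..n} - A" by auto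
  then show ?thesis by simp
qed

lemma new_round [simp]: "used col {0..n} = {}" "rest {0..n} = n"
proof -
  have "{1..n} - {0..n} = {}" "{0..n} \<inter> {1..n} = {1..n}" by auto
  then show "used col {0..n} = {}" "rest {0..n} = n"
    by (simp_all only: colours_empty) simp
qed

lemma used_subset_seen: "used col A \<subseteq> seen col"
  by (rule colours_mono) auto

text \<open>The case \<open>A = {l}\<close> of \<open>used_leaf_step\<close>. It serves for the last
  leaf of a round and for any leaf whose old colour is to disappear.\<close>

lemma last_leaf_seen:
  assumes "l \<in> {1..n}"
  shows "seen (col(l := Some c)) = insert c (used col {l})"
  using assms used_leaf_step[of l "{l}" col c] by simp

section \<open>Existence of legal colours\<close>

lemma ex_legal_leaf:
  assumes "l \<noteq> 0"
  obtains c where "legal col l c"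
proof -
  have "card {1..k} \<ge> 3" using k_eq M_pos by simp
  \<comment> \<open>On an uncoloured vertex \<open>the\<close> gives an arbitrary number; excluding
    it as well still forbids at most two colours.\<close>
  moreover have "card {the (col l), the (col 0)} \<le> 2"
    using card_insert_le_m1[of 2 "{the (col 0)}"] by simp
  ultimately have "\<not> {1..k} \<subseteq> {the (col l), the (col 0)}"
    using card_mono[of "{the (col l), the (col 0)}" "{1..k}"] by auto
  then obtain c where "c \<in> {1..k}" "c \<noteq> the (col l)" "c \<noteq> the (col 0)" by blast
  then have "legal col l c" using assms by (auto simp: legal_def)
  then show ?thesis by (rule that)
qed

lemma ex_unseen:
  assumes "card (seen col) + 1 < k"
  obtains c where "c \<in> {1..k}" "c \<notin> seen col" "col 0 \<noteq> Some c"
proof -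
  have "card (insert (the (col 0)) (seen col)) < card {1..k}"
    using assms card_insert_le_m1[of "k" "seen col" "the (col 0)"] by (simp add: card_insert_if)
  then have "\<not> {1..k} \<subseteq> insert (the (col 0)) (seen col)"
    using card_mono[of "insert (the (col 0)) (seen col)" "{1..k}"] by auto
  then show ?thesis using that by force
qed

lemma ex_legal_centre:
  assumes "card (seen col) \<le> M"
  obtains c where "legal col 0 c"
proof -
  have "card (seen col) + 1 < k" using assms k_eq by simp
  then obtain c where "c \<in> {1..k}" "c \<notin> seen col" "col 0 \<noteq> Some c" by (rule ex_unseen)
  then have "legal col 0 c" by (simp add: legal_def)
  then show ?thesis by (rule that)
qed

text \<open>The colouring is proper, so a colour shown by a leaf is not the centre's and can be
  copied to other leaves.\<close>

lemma legal_used: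
  assumes "position col A" "l \<noteq> 0" "c \<in> seen col" "col l \<noteq> Some c"
  shows "legal col l c"
  using assms by (auto simp: position_def legal_def)

section \<open>Bob's turns\<close>

lemma bob_inv_not_stuck:
  assumes "bob_inv col A" "v \<in> A"
  shows "\<exists>c. legal col v c"
proof (cases "v = 0")
  case True
  then have "card (seen col) \<le> M" using assms by (simp add: bob_inv_def)
  then obtain c where "legal col 0 c" by (rule ex_legal_centre)
  then show ?thesis using True by blast
next
  case False
  then obtain c where "legal col v c" by (rule ex_legal_leaf)
  then show ?thesis by blast
qed

lemma card_used_insert: "card (insert c (used col A)) \<le> card (used col A) + 1"
  by (simp add: card_insert_if)

lemma card_seen_step: "card (seen (col(v := Some c))) \<le> card (seen col) + 1"
proof -
  have "card (seen (col(v := Some c))) \<le> card (insert c (seen col))"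
    by (rule card_mono[OF _ colours_upd_subset]) simp
  also have "\<dots> \<le> card (seen col) + 1"
    by (simp add: card_insert_if)
  finally show ?thesis .
qed

text \<open>A leaf move adds at most one used colour. With the centre done, Bob has one leaf move
  fewer to come, which pays for it; with the centre open, the bound may rise to
  \<open>M + 1\<close>, as \<open>alice_inv\<close> permits.\<close>

lemma bob_step:
  assumes inv: "bob_inv col A" and v: "v \<in> A" and c: "legal col v c"
  shows "alice_inv (col(v := Some c)) (available_after A v)"
proof -
  have pos: "position col A" using inv by (simp add: bob_inv_def)
  have pos': "position (col(v := Some c)) (available_after A v)"
    using position_step[OF pos v c] .
  show ?thesis
  proof (cases "v = 0")
    case True
    have b: "even (rest A)" "card (seen col) \<le> M" "card (used col A) + rest A div 2 \<le> M"
      "flexible col A"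
      using inv v True by (auto simp: bob_inv_def)
    show ?thesis
    proof (cases "A = {0}")
      case A: True
      then show ?thesis
        using pos' b True by (simp add: alice_inv_def available_after_def)
    next
      case A: False
      have "flexible (col(0 := Some c)) (A - {0})"
        using b(4) unfolding flexible_def used_centre_step rest_centre_step by auto
      moreover have A': "available_after A 0 = A - {0}"
        using A by (simp add: available_after_def)
      ultimately show ?thesis
        using pos' b
        unfolding True alice_inv_def A' rest_centre_step used_centre_step by auto
    qed
  next
    case False
    then have l: "v \<in> {1..n}" using v pos by (auto simp: position_def)
    note steps = used_leaf_step[OF v l] rest_leaf_step[OF v l]
    let ?U = "used col A"
    have one: "card (insert c ?U) \<ge> 2 \<or> ?U = {} \<or> insert c ?U = ?U"
      by (cases "c \<in> ?U") (auto simp: insert_absorb card_insert_if Suc_le_eq card_gt_0_iff)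
    show ?thesis
    proof (cases "0 \<in> A")
      case True
      have b: "even (rest A)" "card (seen col) \<le> M" "card ?U + rest A div 2 \<le> M"
        "flexible col A"
        using inv True by (auto simp: bob_inv_def)
      have A': "available_after A v = A - {v}" using True False by (auto simp: available_after_def)
      obtain q where q: "rest A = 2 * q" using b(1) by blast
      have q0: "0 < q" using q steps(3) by simp
      \<comment> \<open>If \<open>?U\<close> is empty, \<open>flexible\<close> provides slack, which
        pays for \<open>c\<close>; if \<open>c\<close> is already used, the old bound
        persists.\<close>
      have "2 \<le> card (insert c ?U) \<or> card (insert c ?U) + q \<le> M"
        using one b q by (auto simp: flexible_def)
      moreover have "card (insert c ?U) + q \<le> M + 1"
        using card_used_insert[of c col A] b(3) q by simp
      moreover have "odd (2 * q - 1)" "(2 * q - 1 + 1) div 2 = q"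
        using q0 by auto
      moreover have "card (seen (col(v := Some c))) \<le> M + 1"
        using card_seen_step[of col v c] b(2) by simp
      ultimately show ?thesis
        using pos' True False unfolding alice_inv_def A' steps q by auto
    next
      case zero: False
      have b: "odd n \<longrightarrow> odd (rest A)" "card ?U + (rest A + 1) div 2 \<le> M"
        "?U \<noteq> {} \<or> card ?U + (rest A + 1) div 2 + 1 \<le> M \<or> rest A \<le> 1"
        using inv zero by (auto simp: bob_inv_def)
      show ?thesis
      proof (cases "A = {v}")
        case True
        have "card (seen (col(v := Some c))) \<le> M"
          using last_leaf_seen[OF l, of col c] card_used_insert[of c col A] b(2) True l by simp
        then show ?thesis
          using pos' True by (simp add: alice_inv_def available_after_def)
      next
        case A: False
        then obtain w where "w \<in> A" "w \<noteq> v" using v by blast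
        then have "w \<in> A - {v}" "w \<in> {1..n}" using zero pos by (auto simp: position_def Suc_le_eq intro!: Nat.gr0I)
        then have r2: "2 \<le> rest A" using rest_leaf_step[of w "A - {v}"] steps by simp
        have A': "available_after A v = A - {v}" using A by (auto simp: available_after_def)
        have half: "(rest A + 1) div 2 = (rest A - 1) div 2 + 1" using r2 by simp
        \<comment> \<open>For empty \<open>?U\<close> the third clause of the invariant gives slack,
          since \<open>rest A\<close> is at least 2; for a repeated colour the spent move of Bob is
          the slack.\<close>
        have "2 \<le> card (insert c ?U) \<or> card (insert c ?U) + (rest A - 1) div 2 + 1 \<le> M"
          using one b(2,3) r2 half by auto
        then have "flexible (col(v := Some c)) (A - {v})"
          unfolding flexible_def steps by blast
        moreover have "card (insert c ?U) + (rest A - 1) div 2 \<le> M"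
          using card_used_insert[of c col A] b(2) half by simp
        moreover have "odd n \<longrightarrow> even (rest A - 1)" using b(1) by auto
        ultimately show ?thesis
          using pos' zero unfolding alice_inv_def A' steps by simp
      qed
    qed
  qed
qed

section \<open>Alice's turns\<close>

lemma alice_step_centre_done:
  assumes inv: "alice_inv col A" and zero: "0 \<notin> A"
  shows "\<exists>v\<in>A. \<exists>c. legal col v c \<and> bob_inv (col(v := Some c)) (available_after A v)"
proof -
  let ?U = "used col A"
  have pos: "position col A" and b: "odd n \<longrightarrow> even (rest A)" "card ?U + rest A div 2 \<le> M"
    "flexible col A"
    using inv zero by (auto simp: alice_inv_def)
  have leaf: "l \<in> {1..n}" if "l \<in> A" for l
    using that zero pos by (cases l) (auto simp: position_def)
  obtain l0 where l0: "l0 \<in> A" using pos by (auto simp: position_def)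
  have copy: "legal col l c" if "l \<in> A" "c \<in> ?U" "col l \<noteq> Some c" for l c
    using legal_used[OF pos, of l c] that leaf[of l] used_subset_seen[of col A] by auto
  \<comment> \<open>Each disjunct of \<open>flexible\<close> yields such a move: copy one of two
    used colours, spend the slack, or copy the only used colour.\<close>
  have "\<exists>l\<in>A. \<exists>c. legal col l c \<and> card (insert c ?U) + rest A div 2 \<le> M"
    using b(3) unfolding flexible_def
  proof (elim disjE exE conjE)
    assume "2 \<le> card ?U"
    then obtain c where "c \<in> ?U" "col l0 \<noteq> Some c" by (rule ex_other_element)
    then show ?thesis
      using copy[OF l0] b(2) l0 by (intro bexI[of _ l0] exI[of _ c]) (auto simp: insert_absorb)
  next
    assume *: "card ?U + rest A div 2 + 1 \<le> M"
    have "l0 \<noteq> 0" using leaf[OF l0] by simp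
    then obtain c where "legal col l0 c" by (rule ex_legal_leaf)
    then show ?thesis
      using card_used_insert[of c col A] * l0 by (intro bexI[of _ l0] exI[of _ c]) auto
  next
    fix y assume y: "?U = {y}" and "\<exists>l\<in>A \<inter> {1..n}. col l \<noteq> Some y"
    then obtain l where "l \<in> A" "col l \<noteq> Some y" by auto
    then show ?thesis
      using copy[of l y] b(2) y by (intro bexI[of _ l] exI[of _ y]) auto
  qed
  then obtain l c where lA: "l \<in> A" and c: "legal col l c"
    and le: "card (insert c ?U) + rest A div 2 \<le> M" by blast
  have l: "l \<in> {1..n}" using leaf[OF lA] .
  note steps = used_leaf_step[OF lA l] rest_leaf_step[OF lA l]
  have pos': "position (col(l := Some c)) (available_after A l)"
    using position_step[OF pos lA c] .
  have "bob_inv (col(l := Some c)) (available_after A l)"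
  proof (cases "A = {l}")
    case True
    \<comment> \<open>By parity Alice ends a round with a leaf only for even \<open>n\<close>. Bob
      then opens the next one, and \<open>2 * M = n + 2\<close> gives exactly the slack in
      \<open>flexible\<close>.\<close>
    then have "rest A = 1" using l by simp
    then have ev: "even n" using b(1) by auto
    have "card (seen (col(l := Some c))) \<le> M"
      using last_leaf_seen[OF l, of col c] le True by simp
    moreover have A': "available_after A l = {0..n}"
      using True by (simp add: available_after_def)
    ultimately show ?thesis
      using pos' ev even_n unfolding bob_inv_def flexible_def A' new_round by auto
  next
    case False
    then have A': "available_after A l = A - {l}" by (simp add: available_after_def)
    have "(rest A - 1 + 1) div 2 = rest A div 2" "odd n \<longrightarrow> odd (rest A - 1)"
      using steps(3) b(1) by auto
    then show ?thesis
      using pos' zero le unfolding bob_inv_def A' steps by auto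
  qed
  then show ?thesis using lA c by blast
qed

text \<open>Copying leaves \<open>used\<close> unchanged while \<open>rest\<close> falls from odd to
  even, so the budget drops from \<open>M + 1\<close> to \<open>M\<close>. The bound on
  \<open>seen\<close> is assumed because the centre stays open to Bob.\<close>

lemma alice_step_copy:
  assumes pos: "position col A" and zero: "0 \<in> A" and l: "l \<in> A" "l \<in> {1..n}"
    and y: "y \<in> used col A" "col l \<noteq> Some y"
    and odd: "odd (rest A)"
    and le: "card (used col A) + (rest A + 1) div 2 \<le> M + 1"
    and flex: "2 \<le> card (used col A) \<or> card (used col A) + (rest A + 1) div 2 \<le> M"
    and seen: "card (seen (col(l := Some y))) \<le> M"
  shows "\<exists>v\<in>A. \<exists>c. legal col v c \<and> bob_inv (col(v := Some c)) (available_after A v)"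
proof -
  have c: "legal col l y"
    using legal_used[OF pos, of l y] l y used_subset_seen[of col A] by auto
  note steps = used_leaf_step[OF l] rest_leaf_step[OF l]
  have A': "available_after A l = A - {l}"
    using zero l by (auto simp: available_after_def)
  have U: "insert y (used col A) = used col A" using y by auto
  have half: "(rest A + 1) div 2 = (rest A - 1) div 2 + 1" "even (rest A - 1)"
    using odd steps(3) by (auto elim: oddE)
  have "flexible (col(l := Some y)) (A - {l})"
    unfolding flexible_def steps U using flex half by auto
  then have "bob_inv (col(l := Some y)) (available_after A l)"
    using position_step[OF pos l(1) c] zero l le half seen
    unfolding bob_inv_def A' steps U by auto
  then show ?thesis using c l by blast
qed

text \<open>Playing the centre removes it from the round, so \<open>seen\<close> may exceed
  \<open>M\<close> afterwards and only the budget for \<open>used\<close> matters.\<close>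

lemma alice_step_centre:
  assumes pos: "position col A" and zero: "0 \<in> A" and R: "A \<noteq> {0}"
    and seen: "card (seen col) \<le> M"
    and par: "odd n \<longrightarrow> odd (rest A)" and le: "card (used col A) + (rest A + 1) div 2 \<le> M"
    and flex: "used col A \<noteq> {} \<or> card (used col A) + (rest A + 1) div 2 + 1 \<le> M \<or> rest A \<le> 1"
  shows "\<exists>v\<in>A. \<exists>c. legal col v c \<and> bob_inv (col(v := Some c)) (available_after A v)"
proof -
  obtain c where c: "legal col 0 c" using ex_legal_centre[OF seen] .
  have A': "available_after A 0 = A - {0}" using R by (simp add: available_after_def)
  have "bob_inv (col(0 := Some c)) (available_after A 0)"
    using position_step[OF pos zero c] par le flex
    unfolding bob_inv_def A' rest_centre_step used_centre_step by auto
  then show ?thesis using c zero by blast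
qed

text \<open>If the leaves show \<open>M + 1\<close> colours, Alice destroys a colour that occurs
  once. Otherwise she copies when two colours are used, and plays the centre when only one
  is.\<close>

lemma alice_step_mid_round:
  assumes pos: "position col A" and zero: "0 \<in> A"
    and odd: "odd (rest A)" and ne: "used col A \<noteq> {}" and seen: "card (seen col) \<le> M + 1"
    and le: "card (used col A) + (rest A + 1) div 2 \<le> M + 1"
    and flex: "2 \<le> card (used col A) \<or> card (used col A) + (rest A + 1) div 2 \<le> M"
  shows "\<exists>v\<in>A. \<exists>c. legal col v c \<and> bob_inv (col(v := Some c)) (available_after A v)"
proof (cases "card (seen col) \<le> M")
  case False
  obtain y where y: "y \<in> used col A" using ne by auto
  have D: "{1..n} - (A \<inter> {1..n}) = {1..n} - A" by auto
  have "rest A < 2 * (card (seen col) - card (used col A))"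
    using False le odd by (auto elim!: oddE)
  then obtain l s where "l \<in> A \<inter> {1..n}" and s: "col l = Some s" "s \<notin> colours col ({1..n} - {l})"
    using ex_unique_colour[of "{1..n}" "A \<inter> {1..n}" col] unfolding D
    by (metis finite_atLeastAtMost inf_le2)
  then have l: "l \<in> A" "l \<in> {1..n}" "col l = Some s" by auto
  \<comment> \<open>A leaf already played shows \<open>y\<close>, so recolouring \<open>l\<close>
    with \<open>y\<close> loses \<open>s\<close> and adds nothing.\<close>
  have yl: "y \<in> colours col ({1..n} - {l})"
    using y l(1) colours_mono[of "{1..n} - A" "{1..n} - {l}" col] by auto
  then have "col l \<noteq> Some y" using s l by auto
  have "seen (col(l := Some y)) = insert y (colours col ({1..n} - {l}))"
    using last_leaf_seen[OF l(2)] .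
  also have "\<dots> = colours col ({1..n} - {l})" using yl by auto
  finally have *: "seen (col(l := Some y)) = colours col ({1..n} - {l})" .
  have "s \<in> seen col" using l by (auto simp: colours_def)
  then have "seen (col(l := Some y)) \<subset> seen col"
    unfolding * using s(2) colours_mono[of "{1..n} - {l}" "{1..n}" col] by blast
  then have "card (seen (col(l := Some y))) < card (seen col)"
    by (intro psubset_card_mono) auto
  then show ?thesis
    using alice_step_copy[OF pos zero l(1,2) y \<open>col l \<noteq> Some y\<close> odd le flex] seen by simp
next
  case True
  have "A \<inter> {1..n} \<noteq> {}" using odd by (metis card.empty even_zero)
  then obtain l where l: "l \<in> A" "l \<in> {1..n}" by blast
  show ?thesis
  proof (cases "2 \<le> card (used col A)")
    case two: True
    then obtain y where y: "y \<in> used col A" "col l \<noteq> Some y" by (rule ex_other_element)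
    then have "seen (col(l := Some y)) \<subseteq> seen col"
      using colours_upd_subset[of col l y "{1..n}"] used_subset_seen[of col A] by auto
    then have "card (seen (col(l := Some y))) \<le> M"
      using True card_mono[of "seen col" "seen (col(l := Some y))"] by simp
    then show ?thesis
      by (rule alice_step_copy[OF pos zero l y odd le flex])
  next
    case False
    then show ?thesis
      using alice_step_centre[OF pos zero _ True] l odd flex ne by auto
  qed
qed

text \<open>After Alice's leaf, \<open>used\<close> is \<open>{c}\<close> and
  \<open>1 + (n - 1) div 2 = M\<close> leaves no slack. So \<open>flexible\<close> must come from
  its third disjunct: another leaf \<open>l'\<close> has to carry a colour other than
  \<open>c\<close>, or none.\<close>

lemma alice_step_new_round_odd:
  assumes pos: "position col {0..n}" and seen: "card (seen col) \<le> M" and n: "odd n" "3 \<le> n"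
  shows "\<exists>v\<in>{0..n}. \<exists>c. legal col v c \<and> bob_inv (col(v := Some c)) (available_after {0..n} v)"
proof -
  have M2: "2 \<le> M" using odd_n n by simp
  have "\<exists>l l' c. l \<in> {1..n} \<and> l' \<in> {1..n} \<and> l \<noteq> l' \<and> legal col l c \<and> col l' \<noteq> Some c \<and>
      card (seen (col(l := Some c))) \<le> M"
  \<comment> \<open>With at most one colour shown (as at the start) a fresh colour is affordable,
    since \<open>M\<close> is at least 2. Otherwise leaves \<open>i\<close>, \<open>j\<close> of
    colours \<open>p\<close>, \<open>q\<close> and a third leaf \<open>m\<close> suffice:
    \<open>m\<close> receives whichever of \<open>p\<close>, \<open>q\<close> suits it, and
    \<open>i\<close> or \<open>j\<close> serves as \<open>l'\<close>.\<close>
  proof (cases "card (seen col) \<le> 1")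
    case True
    then have "card (seen col) + 1 < k" using k_eq M2 by simp
    then obtain c where c: "c \<in> {1..k}" "c \<notin> seen col" "col 0 \<noteq> Some c" by (rule ex_unseen)
    have "legal col 1 c" "col 2 \<noteq> Some c"
      using n c by (auto simp: legal_def colours_def)
    moreover have "card (seen (col(1 := Some c))) \<le> M"
      using card_seen_step[of col 1 c] True M2 by linarith
    moreover have "1 \<in> {1..n}" "2 \<in> {1..n}" "(1::nat) \<noteq> 2" using n by auto
    ultimately show ?thesis by blast
  next
    case False
    then have two: "2 \<le> card (seen col)" by simp
    obtain p where p: "p \<in> seen col" using two by fastforce
    obtain q where q: "q \<in> seen col" "Some p \<noteq> Some q"
      by (rule ex_other_element[OF two])
    obtain i j where ij: "i \<in> {1..n}" "col i = Some p" "j \<in> {1..n}" "col j = Some q"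
      using p q by (auto simp: colours_def)
    have "\<not> {1..n} \<subseteq> {i, j}"
    proof
      assume "{1..n} \<subseteq> {i, j}"
      then have "n \<le> card {i, j}" using card_mono[of "{i, j}" "{1..n}"] by simp
      then show False using n card_insert_le_m1[of 2 "{j}" i] by simp
    qed
    then obtain m where m: "m \<in> {1..n}" "m \<noteq> i" "m \<noteq> j" by blast
    obtain l l' c where l: "l \<in> {1..n}" "l' \<in> {1..n}" "l \<noteq> l'" "c \<in> seen col"
      "col l \<noteq> Some c" "col l' \<noteq> Some c"
    proof (cases "col m = Some p")
      case True
      then show ?thesis using that[of m i q] m ij q by auto
    next
      case False
      then show ?thesis using that[of m j p] m ij p q by auto
    qed
    have "legal col l c" using legal_used[OF pos] l by auto
    moreover have "seen (col(l := Some c)) \<subseteq> seen col"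
      using colours_upd_subset[of col l c "{1..n}"] l by auto
    then have "card (seen (col(l := Some c))) \<le> M"
      using seen card_mono[of "seen col" "seen (col(l := Some c))"] by simp
    ultimately show ?thesis using l by blast
  qed
  then obtain l l' c where l: "l \<in> {1..n}" "l' \<in> {1..n}" "l \<noteq> l'"
    and c: "legal col l c" "col l' \<noteq> Some c" "card (seen (col(l := Some c))) \<le> M" by blast
  have l0: "l \<in> {0..n}" using l by auto
  note steps = used_leaf_step[OF l0 l(1)] rest_leaf_step[OF l0 l(1)]
  have A': "available_after {0..n} l = {0..n} - {l}"
    using l by (auto simp: available_after_def)
  have half: "1 + (n - 1) div 2 \<le> M" "even (n - 1)" using odd_n n by auto
  have "flexible (col(l := Some c)) ({0..n} - {l})"
    unfolding flexible_def steps new_round using l c by auto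
  then have "bob_inv (col(l := Some c)) (available_after {0..n} l)"
    using position_step[OF pos l0 c(1)] half c l unfolding bob_inv_def A' steps new_round by auto
  then show ?thesis using l0 c by blast
qed

lemma alice_step:
  assumes inv: "alice_inv col A"
  shows "\<exists>v\<in>A. \<exists>c. legal col v c \<and> bob_inv (col(v := Some c)) (available_after A v)"
proof (cases "0 \<in> A")
  case False
  then show ?thesis using alice_step_centre_done[OF inv] by simp
next
  case zero: True
  have pos: "position col A" using inv by (simp add: alice_inv_def)
  show ?thesis
  proof (cases "A = {0..n} \<and> card (seen col) \<le> M")
    case False
    then have "odd (rest A)" "used col A \<noteq> {}" "card (seen col) \<le> M + 1"
      "card (used col A) + (rest A + 1) div 2 \<le> M + 1"
      "2 \<le> card (used col A) \<or> card (used col A) + (rest A + 1) div 2 \<le> M"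
      using inv zero unfolding alice_inv_def by (metis (no_types, lifting))+
    then show ?thesis by (rule alice_step_mid_round[OF pos zero])
  next
    case True
    then have A: "A = {0..n}" and seen: "card (seen col) \<le> M" by auto
    show ?thesis
    proof (cases "odd n \<and> 3 \<le> n")
      case True
      then show ?thesis
        using alice_step_new_round_odd[of col] pos seen unfolding A by blast
    next
      case False
      then have n: "even n \<or> n = 1" using n_pos by (cases "n = 2") auto
      have "A \<noteq> {0}" using n_pos unfolding A by auto
      \<comment> \<open>For even \<open>n\<close> the slack is \<open>n div 2 + 1 = M\<close>; for
        \<open>n = 1\<close> a single leaf remains after the centre.\<close>
      moreover have "odd n \<longrightarrow> odd (rest A)" "card (used col A) + (rest A + 1) div 2 \<le> M"
        "used col A \<noteq> {} \<or> card (used col A) + (rest A + 1) div 2 + 1 \<le> M \<or> rest A \<le> 1"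
        using n odd_n even_n unfolding A new_round by auto
      ultimately show ?thesis
        using alice_step_centre[OF pos zero _ seen] by blast
    qed
  qed
qed

section \<open>From positions back to histories\<close>

definition history_inv :: "nat history \<Rightarrow> bool" where
  "history_inv h \<longleftrightarrow> balanced (star_graph n) h \<and>
     (if alice_to_move h then alice_inv else bob_inv)
       (current_colour h) (Collect (may_choose (star_graph n) h))"

lemma may_choose_star: "may_choose (star_graph n) h v \<Longrightarrow> v \<in> {0..n}"
  by (simp add: may_choose_def star_graph_def)

text \<open>Balance is carried along because only it identifies the next set of available vertices
  with \<open>available_after\<close>.\<close>

lemma history_inv_snoc:
  assumes "history_inv h" and v: "may_choose (star_graph n) h v"
    and "(if alice_to_move h then bob_inv else alice_inv) ((current_colour h)(v := Some c))
      (available_after (Collect (may_choose (star_graph n) h)) v)"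
  shows "history_inv (h @ [(v, c)])"
proof -
  have bal: "balanced (star_graph n) h" using assms(1) by (simp add: history_inv_def)
  have "pverts (star_graph n) = {0..n}" by (simp add: star_graph_def)
  then have "Collect (may_choose (star_graph n) (h @ [(v, c)])) =
      available_after (Collect (may_choose (star_graph n) h)) v"
    using available_snoc[OF bal v, of c] by (simp add: available_after_def)
  then show ?thesis
    using assms(3) balanced_snoc[OF bal v]
    by (auto simp: history_inv_def alice_to_move_def split: if_splits)
qed

theorem alice_wins_star: "alice_wins (star_graph n) k"
proof (rule alice_wins_by_invariant[where I = history_inv])
  have "Collect (may_choose (star_graph n) []) = {0..n}"
    by (auto simp: may_choose_def times_chosen_def star_graph_def)
  then show "history_inv []"
    by (auto simp: history_inv_def balanced_def times_chosen_def alice_to_move_def alice_inv_def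
        position_def colours_def)
next
  fix h assume h: "history_inv h" "alice_to_move h"
  then obtain v c where v: "may_choose (star_graph n) h v" and c: "legal (current_colour h) v c"
    and b: "bob_inv ((current_colour h)(v := Some c))
      (available_after (Collect (may_choose (star_graph n) h)) v)"
    using alice_step[of "current_colour h" "Collect (may_choose (star_graph n) h)"]
    by (auto simp: history_inv_def)
  have "legal_move (star_graph n) k h (v, c)"
    using v c legal_colour_star may_choose_star by (simp add: legal_move_def)
  moreover have "history_inv (h @ [(v, c)])"
    using history_inv_snoc[OF h(1) v] b h(2) by simp
  ultimately show "\<exists>m. legal_move (star_graph n) k h m \<and> history_inv (h @ [m])" by blast
next
  fix h v assume h: "history_inv h" "\<not> alice_to_move h"
  show "\<not> stuck (star_graph n) k h v"
  proof
    assume v: "stuck (star_graph n) k h v"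
    then have "\<exists>c. legal (current_colour h) v c"
      using h bob_inv_not_stuck[of "current_colour h" "Collect (may_choose (star_graph n) h)" v]
      by (simp add: stuck_def history_inv_def)
    then show False
      using v legal_colour_star may_choose_star unfolding stuck_def by blast
  qed
next
  fix h m assume h: "history_inv h" "\<not> alice_to_move h" and m: "legal_move (star_graph n) k h m"
  obtain v c where vc: "m = (v, c)" by (cases m)
  then have v: "may_choose (star_graph n) h v" and c: "legal (current_colour h) v c"
    using m legal_colour_star may_choose_star by (auto simp: legal_move_def)
  show "history_inv (h @ [m])"
    unfolding vc using history_inv_snoc[OF h(1) v] bob_step[OF _ _ c] h v
    by (simp add: history_inv_def)
qed

end

theorem theorem3p4:
  fixes n :: nat
  assumes "n \<ge> 1"
  shows "(odd n \<longrightarrow>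
            eternal_game_chromatic_number (star_graph n) \<le> enat (nat \<lceil>real n / 2\<rceil> + 2)) \<and>
         (even n \<and> n \<ge> 4 \<longrightarrow>
            eternal_game_chromatic_number (star_graph n) \<le> enat (n div 2 + 3))"
proof (intro conjI impI)
  assume "odd n"
  then obtain m where m: "n = 2 * m + 1" by (elim oddE)
  have "\<lceil>real n / 2\<rceil> = int m + 1"
    unfolding m by (intro ceiling_unique) auto
  then have k: "nat \<lceil>real n / 2\<rceil> + 2 = m + 1 + 2" by simp
  \<comment> \<open>Here \<open>M\<close> is n/2 rounded up.\<close>
  interpret star_game n "m + 1 + 2" "m + 1"
    by unfold_locales (auto simp: m)
  show "eternal_game_chromatic_number (star_graph n) \<le> enat (nat \<lceil>real n / 2\<rceil> + 2)"
    unfolding k by (rule eternal_game_chromatic_number_le[OF alice_wins_star])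
next
  assume n: "even n \<and> n \<ge> 4"
  interpret star_game n "n div 2 + 3" "n div 2 + 1"
    by unfold_locales (use n in auto)
  show "eternal_game_chromatic_number (star_graph n) \<le> enat (n div 2 + 3)"
    by (rule eternal_game_chromatic_number_le[OF alice_wins_star])
qed

end
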